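(* Let $\hat\rho\ge 0$ be a sufficiently large constant; that is, there exists $\rho_0\ge0$ such that for every constant $\hat\rho\ge\rho_0$ the following hold. (a) For any $z\in[0,1]^{n_x}$, the inequality $$d_\ell^\top y\ge\psi(z)-\hat\rho\,(\mathbf 1^\top x+\mathbf 1^\top z-2x^\top z)$$ is valid for any $(x,y)\in X\times Y$ satisfying $d_\ell^\top y\ge\phi(x)$. (b) If in addition $z\in\{0,1\}^{n_x}$, then this inequality is valid and tight for $d_\ell^\top y\ge\phi(x)$ and can be rewritten as $$d_\ell^\top y\ge\phi(z)-\hat\rho\,(\mathbf 1^\top x+\mathbf 1^\top z-2x^\top z).$$
   Context: $X=\{0,1\}^{n_x}$, $Y\subseteq\mathbb{R}^{n_y}$, $d_\ell\in\mathbb{R}^{n_y}$, $A_\ell\in\mathbb{R}^{m_\ell\times n_x}$, $B_\ell\in\mathbb{R}^{m_\ell\times n_y}$, $h_\ell\in\mathbb{R}^{m_\ell}$; $\mathbf 1$ is the all-ones vector. For $x\in X$, $\phi(x)=\max\{d_\ell^\top y' : y'\in Y,\ B_\ell y'\le h_\ell-A_\ell x\}$, equal to $-\infty$ when infeasible. $\psi$ on $[0,1]^{n_x}$ is an extension of $\phi$, i.e. $\psi(z)=\phi(z)$ whenever $z\in\{0,1\}^{n_x}$, such that, with the other entries fixed, $\psi(z)$ is linear in each individual $z_i$; for example $\psi(z)=\sum_{x\in\{0,1\}^{n_x}}\phi(x)\prod_{i:x_i=1}z_i\prod_{i:x_i=0}(1-z_i)$. Terminology: for inequalities $f(x)\le0$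 and $g(x)\le0$ in $x\in X$, $f(x)\le0$ is valid for $g(x)\le0$ if $f(x)\le g(x)$ for all $x\in X$; it is valid and tight if moreover $g(\hat x)=f(\hat x)$ for some $\hat x\in X$ (tight at $\hat x$). Thus an inequality $d_\ell^\top y\ge r(x)$ is valid for $d_\ell^\top y\ge\phi(x)$ if $r(x)\le\phi(x)$ for all $x\in X$, and tight at $\hat x$ if $r(\hat x)=\phi(\hat x)$.
   Formalization: At x with φ(x) = −∞ the claim can fail (Y = ℝ, d = 1, y ≤ 0, 0 ≤ −x, z = 0, x = 1). So at such x, (a) is asserted only if d^T y is bounded below on Y, and in (b) the validity r(x) ≤ φ(x) is asserted only for x with φ(x) ≠ −∞. *)

theory Defs
  imports "HOL-Analysis.Analysis"
begin

definition binary_vecs :: "(real ^ 'n) set" where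
  "binary_vecs = {x. \<forall>i. x $ i \<in> {0, 1}}"

definition unit_cube :: "(real ^ 'n) set" where
  "unit_cube = {z. \<forall>i. z $ i \<in> {0..1}}"

definition lower_feasible ::
    "(real ^ 'y) set \<Rightarrow> real ^ 'x ^ 'm \<Rightarrow> real ^ 'y ^ 'm \<Rightarrow> real ^ 'm \<Rightarrow> real ^ 'x \<Rightarrow> (real ^ 'y) set" where
  "lower_feasible Y A B h x = {y \<in> Y. B *v y \<le> h - A *v x}"

(* The supremum of the empty set in ereal is -\<infinity>, which is the convention for an infeasible
   lower level. That the supremum is a maximum otherwise is the separate condition
   lower_max_attained. *)
definition value_fun ::
    "(real ^ 'y) set \<Rightarrow> real ^ 'y \<Rightarrow> real ^ 'x ^ 'm \<Rightarrow> real ^ 'y ^ 'm \<Rightarrow> real ^ 'm \<Rightarrow> real ^ 'x \<Rightarrow> ereal" where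
  "value_fun Y d A B h x = (SUP y \<in> lower_feasible Y A B h x. ereal (d \<bullet> y))"

definition lower_max_attained ::
    "(real ^ 'y) set \<Rightarrow> real ^ 'y \<Rightarrow> real ^ 'x ^ 'm \<Rightarrow> real ^ 'y ^ 'm \<Rightarrow> real ^ 'm \<Rightarrow> bool" where
  "lower_max_attained Y d A B h \<longleftrightarrow>
     (\<forall>x \<in> binary_vecs. lower_feasible Y A B h x \<noteq> {} \<longrightarrow>
        (\<exists>y \<in> lower_feasible Y A B h x. \<forall>y' \<in> lower_feasible Y A B h x. d \<bullet> y' \<le> d \<bullet> y))"

definition set_coord :: "real ^ 'n \<Rightarrow> 'n \<Rightarrow> real \<Rightarrow> real ^ 'n" where
  "set_coord z i t = (\<chi> j. if j = i then t else z $ j)"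

(* Linear (i.e. affine) in one coordinate is phrased through convex combinations, so that it also
   makes sense for the value -\<infinity>; recall 0 * (-\<infinity>) = 0 in ereal. *)
definition separately_linear :: "(real ^ 'n \<Rightarrow> ereal) \<Rightarrow> bool" where
  "separately_linear \<psi> \<longleftrightarrow>
     (\<forall>z \<in> unit_cube. \<forall>i. \<forall>s \<in> {0..1}. \<forall>t \<in> {0..1}. \<forall>u \<in> {0..1}.
        \<psi> (set_coord z i ((1 - u) * s + u * t)) =
          ereal (1 - u) * \<psi> (set_coord z i s) + ereal u * \<psi> (set_coord z i t))"

definition multilinear_extension :: "(real ^ 'n \<Rightarrow> ereal) \<Rightarrow> (real ^ 'n \<Rightarrow> ereal) \<Rightarrow> bool" where
  "multilinear_extension \<phi> \<psi> \<longleftrightarrow>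
     (\<forall>z \<in> binary_vecs. \<psi> z = \<phi> z) \<and> separately_linear \<psi>"

(* Right-hand side of the cut built from g at z, as a function of x;
   the vector 1 is the all-ones vector. *)
definition cut_rhs :: "(real ^ 'n \<Rightarrow> ereal) \<Rightarrow> real \<Rightarrow> real ^ 'n \<Rightarrow> real ^ 'n \<Rightarrow> ereal" where
  "cut_rhs g \<rho> z x = g z - ereal (\<rho> * (1 \<bullet> x + 1 \<bullet> z - 2 * (x \<bullet> z)))"

(* The inequality d \<bullet> y \<ge> r x is valid for d \<bullet> y \<ge> \<phi> x, with x ranging over S. *)
definition valid_for :: "(real ^ 'n) set \<Rightarrow> (real ^ 'n \<Rightarrow> ereal) \<Rightarrow> (real ^ 'n \<Rightarrow> ereal) \<Rightarrow> bool" where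
  "valid_for S r \<phi> \<longleftrightarrow> (\<forall>x \<in> S. r x \<le> \<phi> x)"

definition tight_at :: "real ^ 'n \<Rightarrow> (real ^ 'n \<Rightarrow> ereal) \<Rightarrow> (real ^ 'n \<Rightarrow> ereal) \<Rightarrow> bool" where
  "tight_at x r \<phi> \<longleftrightarrow> r x = \<phi> x"

(* Why validity of the cuts can only be asked for on {x. \<phi> x \<noteq> -\<infinity>}: no real \<rho> helps elsewhere. *)
lemma cut_rhs_not_le_infeasible:
  assumes "\<phi> x = -\<infinity>" and "\<phi> z \<noteq> -\<infinity>"
  shows "\<not> cut_rhs \<phi> \<rho> z x \<le> \<phi> x"
  using assms by (cases "\<phi> z") (auto simp: cut_rhs_def)

end

theory Submission
  imports Defs
begin

text \<open>
  The form \<open>1 \<bullet> x + 1 \<bullet> z - 2 * (x \<bullet> z)\<close> is the \<open>\<ell>\<^sub>1\<close> distance of \<open>z\<close> from a binary \<open>x\<close>.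
  Let \<open>M\<close> bound \<open>\<phi>\<close> above on the binary vectors; by separate linearity it bounds \<open>\<psi>\<close> on the whole
  cube. If \<open>\<psi> x \<le> c\<close> and \<open>M \<le> c + K\<close>, then moving from \<open>x\<close> to \<open>z\<close> one coordinate at a time increases
  \<open>\<psi>\<close> by at most \<open>K\<close> times the distance moved, so \<open>\<psi> z \<le> c + K * dist\<close>. Since there are only
  finitely many binary vectors, one \<open>K\<close> serves for all \<open>c = d \<bullet> y\<close> and \<open>c = \<phi> x\<close> that occur.
\<close>

lemma finite_binary_vecs: "finite (binary_vecs :: (real ^ 'n) set)"
proof (rule finite_subset)
  show "binary_vecs \<subseteq> range (\<lambda>T. (\<chi> i. of_bool (i \<in> T)) :: real ^ 'n)"
  proof
    fix x :: "real ^ 'n"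
    assume "x \<in> binary_vecs"
    then have "x = (\<chi> i. of_bool (i \<in> {i. x $ i = 1}))"
      by (auto simp: binary_vecs_def vec_eq_iff)
    then show "x \<in> range (\<lambda>T. (\<chi> i. of_bool (i \<in> T)))" by blast
  qed
qed simp

lemma binary_vecs_subset_unit_cube: "binary_vecs \<subseteq> unit_cube"
proof
  fix x :: "real ^ 'n"
  assume x: "x \<in> binary_vecs"
  have "x $ i \<in> {0..1}" for i
  proof -
    have "x $ i \<in> {0, 1}" using x by (simp add: binary_vecs_def)
    then show ?thesis by auto
  qed
  then show "x \<in> unit_cube" by (simp add: unit_cube_def)
qed

lemma set_coord_nth [simp]: "set_coord z i t $ j = (if j = i then t else z $ j)"
  by (simp add: set_coord_def)

lemma set_coord_self: "set_coord z i (z $ i) = z"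
  by (simp add: vec_eq_iff)

lemma set_coord_in_unit_cube: "z \<in> unit_cube \<Longrightarrow> t \<in> {0..1} \<Longrightarrow> set_coord z i t \<in> unit_cube"
  by (simp add: unit_cube_def)

text \<open>Coordinatewise, the left side is \<open>z $ i\<close> when \<open>x $ i = 0\<close> and
  \<open>1 - z $ i\<close> when \<open>x $ i = 1\<close>.\<close>

lemma cut_distance_eq_sum:
  fixes x z :: "real ^ 'n"
  assumes "x \<in> binary_vecs" and "z \<in> unit_cube"
  shows "1 \<bullet> x + 1 \<bullet> z - 2 * (x \<bullet> z) = (\<Sum>i\<in>UNIV. \<bar>z $ i - x $ i\<bar>)"
proof -
  have "x $ i + z $ i - 2 * (x $ i * z $ i) = \<bar>z $ i - x $ i\<bar>" for i
  proof -
    have "x $ i = 0 \<or> x $ i = 1" "0 \<le> z $ i" "z $ i \<le> 1"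
      using assms by (auto simp: binary_vecs_def unit_cube_def)
    then show ?thesis by auto
  qed
  then show ?thesis
    by (simp add: inner_vec_def sum_distrib_left flip: sum.distrib sum_subtractf)
qed

text \<open>Interpolating real upper bounds, rather than the values themselves, keeps later
  estimates in the reals even where \<psi> is -\<infinity>.\<close>

lemma separately_linear_le:
  assumes \<psi>: "separately_linear \<psi>" and z: "z \<in> unit_cube"
    and s: "s \<in> {0..1}" and t: "t \<in> {0..1}" and u: "u \<in> {0..1}"
    and zi: "z $ i = (1 - u) * s + u * t"
    and p: "\<psi> (set_coord z i s) \<le> ereal p" and q: "\<psi> (set_coord z i t) \<le> ereal q"
  shows "\<psi> z \<le> ereal ((1 - u) * p + u * q)"
proof -
  have "\<psi> z = \<psi> (set_coord z i ((1 - u) * s + u * t))"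
    by (simp add: set_coord_self flip: zi)
  also have "\<dots> = ereal (1 - u) * \<psi> (set_coord z i s) + ereal u * \<psi> (set_coord z i t)"
    using \<psi> z s t u unfolding separately_linear_def by blast
  also have "\<dots> \<le> ereal (1 - u) * ereal p + ereal u * ereal q"
    using p q u by (intro add_mono ereal_mult_left_mono) auto
  finally show ?thesis by simp
qed

text \<open>Induction on a set \<open>S\<close> of coordinates allowed to be fractional: rounding
  coordinate \<open>i\<close> to 0 and to 1 gives two points covered by the induction hypothesis,
  and \<open>z\<close> lies between them.\<close>

lemma separately_linear_le_vertex_bound:
  fixes \<psi> :: "real ^ 'n \<Rightarrow> ereal"
  assumes \<psi>: "separately_linear \<psi>" and M: "\<And>v. v \<in> binary_vecs \<Longrightarrow> \<psi> v \<le> ereal M"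
    and z: "z \<in> unit_cube"
  shows "\<psi> z \<le> ereal M"
proof -
  have "\<psi> z \<le> ereal M" if "\<forall>i. i \<notin> S \<longrightarrow> z $ i \<in> {0, 1}" "z \<in> unit_cube" for S z
    using finite[of S] that
  proof (induction S arbitrary: z rule: finite_induct)
    case empty
    then show ?case by (intro M) (simp add: binary_vecs_def)
  next
    case (insert i S)
    have "\<psi> z \<le> ereal ((1 - z $ i) * M + z $ i * M)"
    proof (rule separately_linear_le[OF \<psi>, where s = 0 and t = 1 and i = i])
      show "\<psi> (set_coord z i 0) \<le> ereal M" "\<psi> (set_coord z i 1) \<le> ereal M"
        using insert.prems by (intro insert.IH set_coord_in_unit_cube; simp)+
    qed (use insert.prems in \<open>auto simp: unit_cube_def\<close>)
    then show ?case by (simp add: algebra_simps)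
  qed
  from this[of UNIV z] show ?thesis using z by simp
qed

lemma separately_linear_le_distance:
  fixes \<psi> :: "real ^ 'n \<Rightarrow> ereal"
  assumes \<psi>: "separately_linear \<psi>" and M: "\<And>v. v \<in> binary_vecs \<Longrightarrow> \<psi> v \<le> ereal M"
    and x: "x \<in> binary_vecs" and c: "\<psi> x \<le> ereal c" and K: "M \<le> c + K" "0 \<le> K"
    and z: "z \<in> unit_cube"
  shows "\<psi> z \<le> ereal (c + K * (1 \<bullet> x + 1 \<bullet> z - 2 * (x \<bullet> z)))"
proof -
  have "\<psi> z \<le> ereal (c + K * (\<Sum>i\<in>S. \<bar>z $ i - x $ i\<bar>))"
    if "\<forall>i. i \<notin> S \<longrightarrow> z $ i = x $ i" "z \<in> unit_cube" for S z
    using finite[of S] that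
  proof (induction S arbitrary: z rule: finite_induct)
    case empty
    then have "z = x" by (simp add: vec_eq_iff)
    then show ?case using c by simp
  next
    case (insert i S)
    define u where "u = \<bar>z $ i - x $ i\<bar>"
    define D where "D = (\<Sum>j\<in>S. \<bar>z $ j - x $ j\<bar>)"
    have xi: "x $ i = 0 \<or> x $ i = 1" using x by (auto simp: binary_vecs_def)
    have zi: "0 \<le> z $ i" "z $ i \<le> 1" using insert.prems by (auto simp: unit_cube_def)
    have u: "u \<in> {0..1}" using xi zi by (auto simp: u_def)
    have D: "(\<Sum>j\<in>S. \<bar>set_coord z i (x $ i) $ j - x $ j\<bar>) = D"
      using insert.hyps by (auto simp: D_def intro!: sum.cong)
    \<comment> \<open>On the line through \<open>z\<close> in direction \<open>i\<close>, the end
      agreeing with \<open>x\<close> has weight \<open>1 - u\<close> and falls under the induction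
      hypothesis; the opposite end has weight \<open>u\<close> and only the global bound
      \<open>M\<close>.\<close>
    have "\<psi> z \<le> ereal ((1 - u) * (c + K * D) + u * M)"
    proof (rule separately_linear_le[OF \<psi>, where s = "x $ i" and t = "1 - x $ i" and i = i])
      show "z $ i = (1 - u) * x $ i + u * (1 - x $ i)"
        using xi zi by (auto simp: u_def)
      have "\<psi> (set_coord z i (x $ i)) \<le>
          ereal (c + K * (\<Sum>j\<in>S. \<bar>set_coord z i (x $ i) $ j - x $ j\<bar>))"
        using insert.prems xi by (intro insert.IH set_coord_in_unit_cube) auto
      then show "\<psi> (set_coord z i (x $ i)) \<le> ereal (c + K * D)" by (simp only: D)
      show "\<psi> (set_coord z i (1 - x $ i)) \<le> ereal M"
        using insert.prems xi
        by (intro separately_linear_le_vertex_bound[OF \<psi> M] set_coord_in_unit_cube) auto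
    qed (use u xi insert.prems in auto)
    \<comment> \<open>The right side exceeds the left by
      \<open>u * (c + K - M) + u * K * D\<close>.\<close>
    also have "(1 - u) * (c + K * D) + u * M \<le> c + K * (u + D)"
    proof -
      have "0 \<le> D" by (simp add: D_def sum_nonneg)
      then have "0 \<le> u * (K * D)" using u K by simp
      moreover have "u * M \<le> u * (c + K)" using u K by (intro mult_left_mono) auto
      ultimately show ?thesis by (simp add: algebra_simps)
    qed
    finally show ?case using insert.hyps by (simp add: u_def D_def)
  qed
  from this[of UNIV z] show ?thesis using x z by (simp add: cut_distance_eq_sum)
qed

lemma cut_rhs_le:
  fixes \<psi> :: "real ^ 'n \<Rightarrow> ereal"
  assumes \<psi>: "separately_linear \<psi>" and M: "\<And>v. v \<in> binary_vecs \<Longrightarrow> \<psi> v \<le> ereal M"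
    and x: "x \<in> binary_vecs" and c: "\<psi> x \<le> ereal c" and \<rho>: "M \<le> c + \<rho>" "0 \<le> \<rho>"
    and z: "z \<in> unit_cube"
  shows "cut_rhs \<psi> \<rho> z x \<le> ereal c"
  using separately_linear_le_distance[OF assms] unfolding cut_rhs_def
  by (cases "\<psi> z") auto

lemma cut_rhs_self:
  assumes "z \<in> binary_vecs"
  shows "cut_rhs g \<rho> z z = g z"
  using cut_distance_eq_sum[of z z] assms binary_vecs_subset_unit_cube
  by (auto simp: cut_rhs_def zero_ereal_def[symmetric])

text \<open>A maximiser bounds the supremum by a real number; an infeasible lower level gives
  -\<infinity>.\<close>

lemma value_fun_less_top:
  assumes "lower_max_attained Y d A B h" and "x \<in> binary_vecs"
  shows "value_fun Y d A B h x < \<infinity>"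
proof (cases "lower_feasible Y A B h x = {}")
  case True
  then show ?thesis by (simp add: value_fun_def bot_ereal_def)
next
  case False
  then obtain y where "\<forall>y' \<in> lower_feasible Y A B h x. d \<bullet> y' \<le> d \<bullet> y"
    using assms unfolding lower_max_attained_def by blast
  then have "value_fun Y d A B h x \<le> ereal (d \<bullet> y)"
    unfolding value_fun_def by (intro SUP_least) simp
  then show ?thesis by (rule le_less_trans) simp
qed

text \<open>At an infeasible \<open>x\<close> every \<open>y\<close> satisfies the premise of (a),
  so a uniform constant there relies on a lower bound for \<open>d \<bullet> y\<close> on
  \<open>Y\<close>. Validity in (b) is restricted because of
  \<open>cut_rhs_not_le_infeasible\<close>.\<close>

theorem proposition1:
  fixes Y :: "(real ^ 'y) set" and d :: "real ^ 'y"
    and A :: "real ^ 'x ^ 'm" and B :: "real ^ 'y ^ 'm" and h :: "real ^ 'm"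
    and \<phi> \<psi> :: "real ^ 'x \<Rightarrow> ereal"
  defines "\<phi> \<equiv> value_fun Y d A B h"
  assumes "lower_max_attained Y d A B h"
    and "multilinear_extension \<phi> \<psi>"
  shows "\<exists>\<rho>\<^sub>0 \<ge> 0. \<forall>\<rho> \<ge> \<rho>\<^sub>0.
     (\<forall>z \<in> unit_cube. \<forall>x \<in> binary_vecs. \<forall>y \<in> Y.
        (\<phi> x = -\<infinity> \<longrightarrow> bdd_below ((\<lambda>y. d \<bullet> y) ` Y)) \<longrightarrow>
        ereal (d \<bullet> y) \<ge> \<phi> x \<longrightarrow> ereal (d \<bullet> y) \<ge> cut_rhs \<psi> \<rho> z x) \<and>
     (\<forall>z \<in> binary_vecs.
        valid_for {x \<in> binary_vecs. \<phi> x \<noteq> -\<infinity>} (cut_rhs \<psi> \<rho> z) \<phi> \<and>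
        (\<exists>x \<in> binary_vecs. tight_at x (cut_rhs \<psi> \<rho> z) \<phi>) \<and>
        (\<forall>x \<in> binary_vecs. cut_rhs \<psi> \<rho> z x = cut_rhs \<phi> \<rho> z x))"
proof -
  have ext: "\<And>z. z \<in> binary_vecs \<Longrightarrow> \<psi> z = \<phi> z" and \<psi>: "separately_linear \<psi>"
    using assms(3) by (auto simp: multilinear_extension_def)
  have top: "\<phi> x \<noteq> \<infinity>" if "x \<in> binary_vecs" for x
    using value_fun_less_top[OF assms(2) that] by (simp add: \<phi>_def)
  \<comment> \<open>Since \<open>real_of_ereal\<close> sends -\<infinity> to 0, infeasible points do
    not disturb this bound; \<open>M\<close> controls the finite values of \<phi> from both
    sides.\<close>
  have "bounded ((\<lambda>x. real_of_ereal (\<phi> x)) ` binary_vecs)"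
    by (intro finite_imp_bounded finite_imageI finite_binary_vecs)
  then obtain M where M: "\<And>x. x \<in> binary_vecs \<Longrightarrow> \<bar>real_of_ereal (\<phi> x)\<bar> \<le> M" and "0 < M"
    by (auto simp: bounded_pos)
  have upper: "\<psi> v \<le> ereal M" if "v \<in> binary_vecs" for v
    using M[OF that] top[OF that] ext[OF that] by (cases "\<phi> v") auto
  have lower: "ereal (- M) \<le> \<phi> x" if "x \<in> binary_vecs" "\<phi> x \<noteq> -\<infinity>" for x
    using M[OF that(1)] that(2) by (cases "\<phi> x") auto
  \<comment> \<open>If \<open>d \<bullet> y\<close> is unbounded below on \<open>Y\<close>, then
    \<open>L\<close> is an arbitrary real.\<close>
  obtain L where L: "bdd_below ((\<lambda>y. d \<bullet> y) ` Y) \<Longrightarrow> y \<in> Y \<Longrightarrow> L \<le> d \<bullet> y" for y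
    unfolding bdd_below_def by blast
  \<comment> \<open>Each \<open>c\<close> to be used is at least \<open>-M\<close> (feasible
    \<open>x\<close>) or at least \<open>L\<close> (infeasible \<open>x\<close>), so
    \<open>M \<le> c + \<rho>\<close> for every \<rho> from \<open>\<rho>\<^sub>0\<close>
    on.\<close>
  define \<rho>\<^sub>0 where "\<rho>\<^sub>0 = M - min (- M) L"
  have "0 \<le> \<rho>\<^sub>0" using \<open>0 < M\<close> by (simp add: \<rho>\<^sub>0_def)
  have cut: "cut_rhs \<psi> \<rho> z x \<le> ereal c"
    if "\<rho>\<^sub>0 \<le> \<rho>" "z \<in> unit_cube" "x \<in> binary_vecs" "\<phi> x \<le> ereal c" "min (- M) L \<le> c" for \<rho> z x c
    using that \<open>0 \<le> \<rho>\<^sub>0\<close> ext[of x] by (intro cut_rhs_le[OF \<psi> upper]) (auto simp: \<rho>\<^sub>0_def)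
  show ?thesis
  proof (intro exI[of _ \<rho>\<^sub>0] conjI allI ballI impI)
    show "0 \<le> \<rho>\<^sub>0" by fact
  next
    fix \<rho> and z x :: "real ^ 'x" and y
    assume \<rho>: "\<rho>\<^sub>0 \<le> \<rho>" and z: "z \<in> unit_cube" and x: "x \<in> binary_vecs" and y: "y \<in> Y"
      and bdd: "\<phi> x = -\<infinity> \<longrightarrow> bdd_below ((\<lambda>y. d \<bullet> y) ` Y)" and le: "\<phi> x \<le> ereal (d \<bullet> y)"
    have "min (- M) L \<le> d \<bullet> y"
    proof (cases "\<phi> x = -\<infinity>")
      case True
      then show ?thesis using L bdd y by fastforce
    next
      case False
      then have "ereal (- M) \<le> ereal (d \<bullet> y)" using lower[OF x] le by (blast intro: order_trans)
      then show ?thesis by simp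
    qed
    then show "cut_rhs \<psi> \<rho> z x \<le> ereal (d \<bullet> y)" using cut \<rho> z x le by blast
  next
    fix \<rho> and z :: "real ^ 'x"
    assume \<rho>: "\<rho>\<^sub>0 \<le> \<rho>" and z: "z \<in> binary_vecs"
    show "valid_for {x \<in> binary_vecs. \<phi> x \<noteq> -\<infinity>} (cut_rhs \<psi> \<rho> z) \<phi>"
      unfolding valid_for_def
    proof
      fix x
      assume x: "x \<in> {x \<in> binary_vecs. \<phi> x \<noteq> -\<infinity>}"
      \<comment> \<open>With both infinities excluded, the value of \<phi> at \<open>x\<close>
        itself serves as \<open>c\<close>.\<close>
      then obtain c where c: "\<phi> x = ereal c" using top by (cases "\<phi> x") auto
      then have "- M \<le> c" using lower[of x] x by simp
      then show "cut_rhs \<psi> \<rho> z x \<le> \<phi> x"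
        using cut[of \<rho> z x c] \<rho> z x c binary_vecs_subset_unit_cube by auto
    qed
    show "\<exists>x \<in> binary_vecs. tight_at x (cut_rhs \<psi> \<rho> z) \<phi>"
      \<comment> \<open>Tightness occurs at \<open>x = z\<close>, where the distance term
        vanishes.\<close>
      using z ext[OF z] by (intro bexI[of _ z]) (simp_all add: tight_at_def cut_rhs_self)
    show "cut_rhs \<psi> \<rho> z x = cut_rhs \<phi> \<rho> z x" for x
      using ext[OF z] by (simp add: cut_rhs_def)
  qed
qed

end
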